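(* Let $p\in\mathbb{R}[x_1,\dots,x_n]$ be a polynomial with support $S(p)$, and let $B$ be any SOS basis of $p$. Then $$|B|\;\ge\;\frac{\sqrt{1+8|S(p)|}-1}{2}.$$
   Context: $S(p)$ is the set of monomials appearing in $p$ with nonzero coefficient. For a finite set $B$ of monomials in $x_1,\dots,x_n$, $\mathbf{z}_B(\mathbf{x})$ denotes the vector of the monomials in $B$. $B$ is an SOS basis of $p$ if there is a positive semidefinite real symmetric matrix $Q$ with $p(\mathbf{x})=\mathbf{z}_B(\mathbf{x})^\top Q\,\mathbf{z}_B(\mathbf{x})$. *)

theory Defs
  imports
    Complex_Main
    "HOL-Library.Poly_Mapping"
    "Jordan_Normal_Form.Matrix"
begin

text \<open>
  A monomial is its exponent vector, a finitely supported map from variable indices to exponents;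
  the variables \<open>x\<^sub>1, \<dots>, x\<^sub>n\<close> carry the indices \<open>1, \<dots>, n\<close>. A polynomial is a finitely supported
  map from monomials to coefficients, with the convolution product of
  \<^theory>\<open>HOL-Library.Poly_Mapping\<close>.
\<close>

type_synonym monomial = "nat \<Rightarrow>\<^sub>0 nat"
type_synonym real_mpoly = "monomial \<Rightarrow>\<^sub>0 real"

definition monomials :: "nat \<Rightarrow> monomial set" where
  "monomials n = {m. Poly_Mapping.keys m \<subseteq> {1..n}}"

definition support :: "real_mpoly \<Rightarrow> monomial set" where
  "support p = Poly_Mapping.keys p"

definition polynomials :: "nat \<Rightarrow> real_mpoly set" where
  "polynomials n = {p. support p \<subseteq> monomials n}"

definition const_poly :: "real \<Rightarrow> real_mpoly" where
  "const_poly c = Poly_Mapping.single 0 c"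

definition monomial_poly :: "monomial \<Rightarrow> real_mpoly" where
  "monomial_poly m = Poly_Mapping.single m 1"

definition psd_mat :: "nat \<Rightarrow> real mat \<Rightarrow> bool" where
  "psd_mat k Q \<longleftrightarrow>
     Q \<in> carrier_mat k k \<and> transpose_mat Q = Q \<and> (\<forall>v \<in> carrier_vec k. 0 \<le> v \<bullet> (Q *\<^sub>v v))"

text \<open>The list fixes the order in which the monomials are arranged in the vector.\<close>

definition monomial_vec :: "monomial list \<Rightarrow> real_mpoly vec" where
  "monomial_vec bs = vec_of_list (map monomial_poly bs)"

definition sos_basis :: "nat \<Rightarrow> monomial set \<Rightarrow> real_mpoly \<Rightarrow> bool" where
  "sos_basis n B p \<longleftrightarrow>
     finite B \<and> B \<subseteq> monomials n \<and>
     (\<exists>bs Q. distinct bs \<and> set bs = B \<and> psd_mat (card B) Q \<and>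
        p = monomial_vec bs \<bullet> (map_mat const_poly Q *\<^sub>v monomial_vec bs))"

end

theory Submission
  imports Defs
begin

text \<open>Expanding the Gram form of \<open>p\<close> over \<open>B\<close> writes
  \<open>p\<close> as a combination of products of two elements of \<open>B\<close>, so every
  monomial of \<open>p\<close> is such a product (\<open>support_gram_form\<close>). Multiplication
  of monomials is commutative, so with \<open>k = card B\<close> at most
  \<open>k * (k + 1) / 2\<close> distinct products occur (\<open>card_symmetric_image_le\<close>).
  Solving the resulting quadratic inequality for \<open>k\<close> gives the bound.\<close>

lemma keys_monomial_const_monomial:
  "Poly_Mapping.keys (monomial_poly a * (const_poly c * monomial_poly b)) \<subseteq> {a + b}"
  by (simp add: monomial_poly_def const_poly_def mult_single)

lemma gram_form_eq_sum:
  assumes "Q \<in> carrier_mat (length bs) (length bs)"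
  shows "monomial_vec bs \<bullet> (map_mat const_poly Q *\<^sub>v monomial_vec bs) =
    (\<Sum>i<length bs. \<Sum>j<length bs.
      monomial_poly (bs ! i) * (const_poly (Q $$ (i, j)) * monomial_poly (bs ! j)))"
  using assms
  by (simp add: monomial_vec_def scalar_prod_def vec_of_list_index sum_distrib_left lessThan_atLeast0)

text \<open>Each term of the expanded double sum contributes at most the key
  \<open>bs ! i + bs ! j\<close>, the product of two monomials being the sum of their exponent
  vectors. Zero entries of \<open>Q\<close> and cancellation between terms can only remove keys,
  hence an inclusion.\<close>

lemma support_gram_form:
  assumes "Q \<in> carrier_mat (length bs) (length bs)"
  shows "support (monomial_vec bs \<bullet> (map_mat const_poly Q *\<^sub>v monomial_vec bs)) \<subseteq>
    (\<lambda>(i, j). bs ! i + bs ! j) ` ({..<length bs} \<times> {..<length bs})"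
proof -
  have "support (monomial_vec bs \<bullet> (map_mat const_poly Q *\<^sub>v monomial_vec bs)) \<subseteq>
    (\<Union>i<length bs. \<Union>j<length bs. {bs ! i + bs ! j})"
    unfolding support_def gram_form_eq_sum[OF assms]
    by (intro order_trans[OF Poly_Mapping.keys_sum] UN_mono order_refl keys_monomial_const_monomial)
  then show ?thesis
    by fastforce
qed

text \<open>By symmetry the values on one triangle of the index square, diagonal included, already
  exhaust the image. Doubling the cardinality avoids division in \<open>nat\<close>.\<close>

lemma card_symmetric_image_le:
  fixes f :: "nat \<Rightarrow> nat \<Rightarrow> 'a"
  assumes sym: "\<And>i j. f i j = f j i"
  shows "2 * card ((\<lambda>(i, j). f i j) ` ({..<k} \<times> {..<k})) \<le> k * (k + 1)"
proof -
  let ?T = "SIGMA j:{..<k}. {..j}"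
  have "f i j \<in> (\<lambda>(i, j). f i j) ` ?T" if "i < k" "j < k" for i j
  proof (cases "j \<le> i")
    case True
    with that show ?thesis by force
  next
    case False
    with that have "(j, i) \<in> ?T" by simp
    with sym[of i j] show ?thesis by force
  qed
  then have "card ((\<lambda>(i, j). f i j) ` ({..<k} \<times> {..<k})) \<le> card ((\<lambda>(i, j). f i j) ` ?T)"
    by (intro card_mono) auto
  also have "\<dots> \<le> card ?T"
    by (rule card_image_le) simp
  also have "2 * card ?T = k * (k + 1)"
    \<comment> \<open>The row of \<open>?T\<close> over \<open>j\<close> has \<open>Suc j\<close>
      points, which leaves the formula for triangular numbers.\<close>
    by (simp, induction k) auto
  finally show ?thesis by simp
qed

theorem lemma6:
  fixes n :: nat and p :: real_mpoly and B :: "monomial set"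
  assumes "p \<in> polynomials n"
    and "sos_basis n B p"
  shows "real (card B) \<ge> (sqrt (1 + 8 * real (card (support p))) - 1) / 2"
proof -
  obtain bs Q where bs: "distinct bs" "set bs = B" and Q: "psd_mat (card B) Q"
    and p: "p = monomial_vec bs \<bullet> (map_mat const_poly Q *\<^sub>v monomial_vec bs)"
    using assms(2) unfolding sos_basis_def by blast
  define k where "k = card B"
  \<comment> \<open>Distinctness of \<open>bs\<close> makes the size of \<open>Q\<close>, given as
    \<open>card B\<close>, agree with the index range of the list.\<close>
  have len: "length bs = k"
    using distinct_card[OF bs(1)] bs(2) by (simp add: k_def)
  have "support p \<subseteq> (\<lambda>(i, j). bs ! i + bs ! j) ` ({..<k} \<times> {..<k})"
    using support_gram_form[of Q bs] Q unfolding p len psd_mat_def k_def by blast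
  then have "card (support p) \<le> card ((\<lambda>(i, j). bs ! i + bs ! j) ` ({..<k} \<times> {..<k}))"
    by (intro card_mono) auto
  with card_symmetric_image_le[of "\<lambda>i j. bs ! i + bs ! j" k]
  have "2 * card (support p) \<le> k * (k + 1)"
    by (simp add: add.commute)
  then have "2 * real (card (support p)) \<le> real k * (real k + 1)"
    using of_nat_le_iff[where 'a = real, of "2 * card (support p)" "k * (k + 1)"]
    by (simp add: algebra_simps)
  \<comment> \<open>Multiplying by 4 and adding 1 completes the square, since
    \<open>4 * k * (k + 1) + 1\<close> is the square of \<open>2 * k + 1\<close>.\<close>
  then have "1 + 8 * real (card (support p)) \<le> (2 * real k + 1)\<^sup>2"
    by (simp add: power2_eq_square algebra_simps)
  then have "sqrt (1 + 8 * real (card (support p))) \<le> 2 * real k + 1"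
    by (intro real_le_lsqrt) auto
  then show ?thesis
    by (simp add: k_def)
qed

end
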